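(* Assume $p^{A\vee},p^{S\vee},y^\vee,p^{A\wedge},p^{S\wedge},y^\wedge,e^{S\downarrow},p^{S\downarrow},e^{S\uparrow},p^{S\uparrow}$ form a feasible solution to the Envelope model. Then $(p^{A\vee},p^{A\wedge},e^{S\downarrow},e^{S\uparrow})$ is feasible in the Rectangular model. Consequently, the optimal value of the Envelope model is less than or equal to the optimal value of the Rectangular model.
   Context: **Distribution system.** $T\ge 1$ is an integer, $S_T=\{1,\dots,T\}$, $\tau>0$. $S_N$ is a finite set of nodes containing node $1$; $S_D,S_G,S_S\subseteq S_N$ are the sets of loads, generators and energy storage systems (ESSs). For each period $t$ the variables are $p_t^A\in\mathbb{R}$ (aggregate power), $p_t^S=(p_{it}^S)_{i\in S_S}$, $e_t^S=(e_{it}^S)_{i\in S_S}$ (stored energy), and $y_t=(p_{it}^D,q_{it}^D,p_{it}^G,q_{it}^G,q_{it}^S,p_{it}^N,q_{it}^N)_{i\in S_N}$; quantities of a device type not present at node $i$ are $0$. Real data are given: $\underline P_{it}^D,\overline P_{it}^D,\eta_{it}^D,\underline P_{it}^G,\overline P_{it}^G,\overline S_{it}^G,\overline S_i^S,\underline E_i^S,\overline E_i^S$, with $\overline P_i^{SD},\overline P_i^{SC}>0$, $\kappa_i^S,\eta_i^{SD},\eta_i^{SC}\in(0,1]$, a convex set $C_N$, and a given initial stored energy $e_0^S=(e_{i0}^S)_{i\in S_S}$ with $\underline E_i^S\le e_{i0}^S\le\overline E_i^S$ for all $i$. **The set $C_t$.** $C_t$ is the set of $(p_t^A,p_t^S,y_t)$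 with: $\underline P_{it}^D\le p_{it}^D\le\overline P_{it}^D$ and $q_{it}^D=\eta_{it}^Dp_{it}^D$ for $i\in S_D$; $\underline P_{it}^G\le p_{it}^G\le\overline P_{it}^G$ and $(p_{it}^G)^2+(q_{it}^G)^2\le(\overline S_{it}^G)^2$ for $i\in S_G$; $-\overline P_i^{SC}\le p_{it}^S\le\overline P_i^{SD}$ and $(p_{it}^S)^2+(q_{it}^S)^2\le(\overline S_i^S)^2$ for $i\in S_S$; $p_{it}^N=p_{it}^G+p_{it}^S-p_{it}^D$ and $q_{it}^N=q_{it}^G+q_{it}^S-q_{it}^D$ for $i\in S_N$; $p_t^A=p_{1t}^N$; $((p_{it}^N)_{i\in S_N},(q_{it}^N)_{i\in S_N})\in C_N$. It is assumed that $C_t$ is convex and closed. Let $F_i(p)=\max\{p,0\}\tau/\eta_i^{SD}+\min\{p,0\}\tau\eta_i^{SC}$. **Models.** $\phi:\mathbb{R}^T\times\mathbb{R}^T\to\mathbb{R}$ is a function; both models maximize $\phi(p^{A\vee},p^{A\wedge})$ and the optimal value is the supremum over the feasible set, in $[-\infty,\infty]$. *Envelope model:* variables $p^{A\vee},p^{A\wedge}\in\mathbb{R}^T$; $p_t^{S\vee},y_t^\vee,p_t^{S\wedge},y_t^\wedge,p_t^{S\downarrow},p_t^{S\uparrow}$ for $t\in S_T$; $e_t^{S\downarrow},e_t^{S\uparrow}$ for $t\in S_T\cup\{0\}$. Constraints: $p_t^{A\vee}\le p_t^{A\wedge}$ for all $t\in S_T$; $e_{i0}^{S\downarrow}=e_{i0}^{S\uparrow}=e_{i0}^S$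 for all $i\in S_S$; and for all $i\in S_S$, $t\in S_T$: $e_{it}^{S\uparrow}=\kappa_i^Se_{i(t-1)}^{S\uparrow}-F_i(p_{it}^{S\downarrow})$, $e_{it}^{S\downarrow}=\kappa_i^Se_{i(t-1)}^{S\downarrow}-F_i(p_{it}^{S\uparrow})$, $(p_t^{A\vee},p_t^{S\vee},y_t^\vee),(p_t^{A\wedge},p_t^{S\wedge},y_t^\wedge)\in C_t$, $p_{it}^{S\downarrow}\le p_{it}^{S\vee}\le p_{it}^{S\uparrow}$, $p_{it}^{S\downarrow}\le p_{it}^{S\wedge}\le p_{it}^{S\uparrow}$, $\underline E_i^S\le e_{it}^{S\downarrow}\le\overline E_i^S$, $\underline E_i^S\le e_{it}^{S\uparrow}\le\overline E_i^S$. *Rectangular model:* $(p^{A\vee},p^{A\wedge},e^{S\downarrow},e^{S\uparrow})$, with $e^{S\downarrow}=(e_{it}^{S\downarrow})$, $e^{S\uparrow}=(e_{it}^{S\uparrow})$ for $i\in S_S$, $t\in S_T\cup\{0\}$, is feasible if $p_t^{A\vee}\le p_t^{A\wedge}$ for all $t\in S_T$; $e_{i0}^{S\downarrow}\le e_{i0}^S\le e_{i0}^{S\uparrow}$ for all $i$; $\underline E_i^S\le e_{it}^{S\downarrow}\le e_{it}^{S\uparrow}\le\overline E_i^S$ for all $i\in S_S$, $t\in S_T\cup\{0\}$; and for all $t\in S_T$ and all $e_{t-1}^S\in\prod_{i\in S_S}[e_{i(t-1)}^{S\downarrow},e_{i(t-1)}^{S\uparrow}]$ there exist $e_t^{S\vee},p_t^{S\vee},y_t^\vee,e_t^{S\wedge},p_t^{S\wedge},y_t^\wedge$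 with $(p_t^{A\vee},p_t^{S\vee},y_t^\vee),(p_t^{A\wedge},p_t^{S\wedge},y_t^\wedge)\in C_t$ and, for all $i\in S_S$, $e_{it}^{S\vee},e_{it}^{S\wedge}\in[e_{it}^{S\downarrow},e_{it}^{S\uparrow}]$, $e_{it}^{S\vee}=\kappa_i^Se_{i(t-1)}^S-F_i(p_{it}^{S\vee})$, $e_{it}^{S\wedge}=\kappa_i^Se_{i(t-1)}^S-F_i(p_{it}^{S\wedge})$. *)

theory Defs
  imports "HOL-Analysis.Analysis"
begin

text \<open>
  The set of nodes is the finite type \<open>'n\<close>, and a node-indexed quantity is a vector in
  \<open>real ^ 'n\<close>.  A quantity that exists only at the nodes carrying some type of device is
  represented by a vector that vanishes at all other nodes.
\<close>

record ('n::finite) distribution_data =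
  horizon :: nat
  tau :: real
  node1 :: 'n
  loads :: "'n set"
  generators :: "'n set"
  storages :: "'n set"
  P_D_min :: "'n \<Rightarrow> nat \<Rightarrow> real"
  P_D_max :: "'n \<Rightarrow> nat \<Rightarrow> real"
  eta_D :: "'n \<Rightarrow> nat \<Rightarrow> real"
  P_G_min :: "'n \<Rightarrow> nat \<Rightarrow> real"
  P_G_max :: "'n \<Rightarrow> nat \<Rightarrow> real"
  S_G_max :: "'n \<Rightarrow> nat \<Rightarrow> real"
  S_S_max :: "'n \<Rightarrow> real"
  E_S_min :: "'n \<Rightarrow> real"
  E_S_max :: "'n \<Rightarrow> real"
  P_SD_max :: "'n \<Rightarrow> real"
  P_SC_max :: "'n \<Rightarrow> real"
  kappa_S :: "'n \<Rightarrow> real"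
  eta_SD :: "'n \<Rightarrow> real"
  eta_SC :: "'n \<Rightarrow> real"
  C_N :: "((real ^ 'n) \<times> (real ^ 'n)) set"
  e_S_init :: "'n \<Rightarrow> real"

text \<open>The components of \<open>y\<close> are, in this order,
  \<open>p\<^sup>D, q\<^sup>D, p\<^sup>G, q\<^sup>G, q\<^sup>S, p\<^sup>N, q\<^sup>N\<close>.\<close>

type_synonym 'n node_vars =
  "(real ^ 'n) \<times> (real ^ 'n) \<times> (real ^ 'n) \<times> (real ^ 'n) \<times> (real ^ 'n) \<times> (real ^ 'n) \<times> (real ^ 'n)"

definition supported_on :: "'n::finite set \<Rightarrow> (real ^ 'n) set" where
  "supported_on A = {x. \<forall>i. i \<notin> A \<longrightarrow> x $ i = 0}"

definition period_set ::
  "'n::finite distribution_data \<Rightarrow> nat \<Rightarrow> (real \<times> (real ^ 'n) \<times> 'n node_vars) set" where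
  "period_set D t = {(pA, pS, pD, qD, pG, qG, qS, pN, qN).
     pD \<in> supported_on (loads D) \<and> qD \<in> supported_on (loads D) \<and>
     pG \<in> supported_on (generators D) \<and> qG \<in> supported_on (generators D) \<and>
     pS \<in> supported_on (storages D) \<and> qS \<in> supported_on (storages D) \<and>
     (\<forall>i\<in>loads D. P_D_min D i t \<le> pD $ i \<and> pD $ i \<le> P_D_max D i t \<and>
        qD $ i = eta_D D i t * pD $ i) \<and>
     (\<forall>i\<in>generators D. P_G_min D i t \<le> pG $ i \<and> pG $ i \<le> P_G_max D i t \<and>
        (pG $ i)\<^sup>2 + (qG $ i)\<^sup>2 \<le> (S_G_max D i t)\<^sup>2) \<and>
     (\<forall>i\<in>storages D. - P_SC_max D i \<le> pS $ i \<and> pS $ i \<le> P_SD_max D i \<and>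
        (pS $ i)\<^sup>2 + (qS $ i)\<^sup>2 \<le> (S_S_max D i)\<^sup>2) \<and>
     (\<forall>i. pN $ i = pG $ i + pS $ i - pD $ i) \<and>
     (\<forall>i. qN $ i = qG $ i + qS $ i - qD $ i) \<and>
     pA = pN $ node1 D \<and>
     (pN, qN) \<in> C_N D}"

definition energy_drop :: "'n::finite distribution_data \<Rightarrow> 'n \<Rightarrow> real \<Rightarrow> real" where
  "energy_drop D i p = max p 0 * tau D / eta_SD D i + min p 0 * tau D * eta_SC D i"

definition distribution_system :: "'n::finite distribution_data \<Rightarrow> bool" where
  "distribution_system D \<longleftrightarrow>
     horizon D \<ge> 1 \<and> tau D > 0 \<and>
     (\<forall>i\<in>storages D. P_SD_max D i > 0 \<and> P_SC_max D i > 0 \<and>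
        kappa_S D i \<in> {0<..1} \<and> eta_SD D i \<in> {0<..1} \<and> eta_SC D i \<in> {0<..1} \<and>
        E_S_min D i \<le> e_S_init D i \<and> e_S_init D i \<le> E_S_max D i) \<and>
     convex (C_N D) \<and>
     (\<forall>t\<in>{1..horizon D}. convex (period_set D t) \<and> closed (period_set D t))"

text \<open>
  The suffixes \<open>_v\<close>, \<open>_w\<close>, \<open>_lo\<close>, \<open>_hi\<close> stand for the superscripts
  \<open>\<or>\<close>, \<open>\<and>\<close>, \<open>\<down>\<close>, \<open>\<up>\<close>.  A time-indexed quantity is a function on \<open>nat\<close> that is
  \<open>undefined\<close> off its index set, so that \<open>{1..T} \<rightarrow>\<^sub>E UNIV\<close> represents the space of
  all families indexed by \<open>{1..T}\<close>, and an arbitrary objective function of such families is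
  evaluated at unique representatives.
\<close>

definition envelope_feasible ::
  "'n::finite distribution_data \<Rightarrow>
   (nat \<Rightarrow> real) \<Rightarrow> (nat \<Rightarrow> real ^ 'n) \<Rightarrow> (nat \<Rightarrow> 'n node_vars) \<Rightarrow>
   (nat \<Rightarrow> real) \<Rightarrow> (nat \<Rightarrow> real ^ 'n) \<Rightarrow> (nat \<Rightarrow> 'n node_vars) \<Rightarrow>
   (nat \<Rightarrow> real ^ 'n) \<Rightarrow> (nat \<Rightarrow> real ^ 'n) \<Rightarrow>
   (nat \<Rightarrow> real ^ 'n) \<Rightarrow> (nat \<Rightarrow> real ^ 'n) \<Rightarrow> bool" where
  "envelope_feasible D pA_v pS_v y_v pA_w pS_w y_w e_lo p_lo e_hi p_hi \<longleftrightarrow>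
     pA_v \<in> {1..horizon D} \<rightarrow>\<^sub>E UNIV \<and> pA_w \<in> {1..horizon D} \<rightarrow>\<^sub>E UNIV \<and>
     pS_v \<in> {1..horizon D} \<rightarrow>\<^sub>E supported_on (storages D) \<and>
     pS_w \<in> {1..horizon D} \<rightarrow>\<^sub>E supported_on (storages D) \<and>
     y_v \<in> {1..horizon D} \<rightarrow>\<^sub>E UNIV \<and> y_w \<in> {1..horizon D} \<rightarrow>\<^sub>E UNIV \<and>
     p_lo \<in> {1..horizon D} \<rightarrow>\<^sub>E supported_on (storages D) \<and>
     p_hi \<in> {1..horizon D} \<rightarrow>\<^sub>E supported_on (storages D) \<and>
     e_lo \<in> {0..horizon D} \<rightarrow>\<^sub>E supported_on (storages D) \<and>
     e_hi \<in> {0..horizon D} \<rightarrow>\<^sub>E supported_on (storages D) \<and>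
     (\<forall>t\<in>{1..horizon D}. pA_v t \<le> pA_w t) \<and>
     (\<forall>i\<in>storages D. e_lo 0 $ i = e_S_init D i \<and> e_hi 0 $ i = e_S_init D i) \<and>
     (\<forall>t\<in>{1..horizon D}.
        (pA_v t, pS_v t, y_v t) \<in> period_set D t \<and>
        (pA_w t, pS_w t, y_w t) \<in> period_set D t) \<and>
     (\<forall>i\<in>storages D. \<forall>t\<in>{1..horizon D}.
        e_hi t $ i = kappa_S D i * e_hi (t - 1) $ i - energy_drop D i (p_lo t $ i) \<and>
        e_lo t $ i = kappa_S D i * e_lo (t - 1) $ i - energy_drop D i (p_hi t $ i) \<and>
        p_lo t $ i \<le> pS_v t $ i \<and> pS_v t $ i \<le> p_hi t $ i \<and>
        p_lo t $ i \<le> pS_w t $ i \<and> pS_w t $ i \<le> p_hi t $ i \<and>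
        E_S_min D i \<le> e_lo t $ i \<and> e_lo t $ i \<le> E_S_max D i \<and>
        E_S_min D i \<le> e_hi t $ i \<and> e_hi t $ i \<le> E_S_max D i)"

definition rectangular_feasible ::
  "'n::finite distribution_data \<Rightarrow> (nat \<Rightarrow> real) \<Rightarrow> (nat \<Rightarrow> real) \<Rightarrow>
   (nat \<Rightarrow> real ^ 'n) \<Rightarrow> (nat \<Rightarrow> real ^ 'n) \<Rightarrow> bool" where
  "rectangular_feasible D pA_v pA_w e_lo e_hi \<longleftrightarrow>
     pA_v \<in> {1..horizon D} \<rightarrow>\<^sub>E UNIV \<and> pA_w \<in> {1..horizon D} \<rightarrow>\<^sub>E UNIV \<and>
     e_lo \<in> {0..horizon D} \<rightarrow>\<^sub>E supported_on (storages D) \<and>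
     e_hi \<in> {0..horizon D} \<rightarrow>\<^sub>E supported_on (storages D) \<and>
     (\<forall>t\<in>{1..horizon D}. pA_v t \<le> pA_w t) \<and>
     (\<forall>i\<in>storages D. e_lo 0 $ i \<le> e_S_init D i \<and> e_S_init D i \<le> e_hi 0 $ i) \<and>
     (\<forall>i\<in>storages D. \<forall>t\<in>{0..horizon D}.
        E_S_min D i \<le> e_lo t $ i \<and> e_lo t $ i \<le> e_hi t $ i \<and> e_hi t $ i \<le> E_S_max D i) \<and>
     (\<forall>t\<in>{1..horizon D}. \<forall>e\<in>supported_on (storages D).
        (\<forall>i\<in>storages D. e $ i \<in> {e_lo (t - 1) $ i .. e_hi (t - 1) $ i}) \<longrightarrow>
        (\<exists>e_v\<in>supported_on (storages D). \<exists>pS_v y_v.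
         \<exists>e_w\<in>supported_on (storages D). \<exists>pS_w y_w.
           (pA_v t, pS_v, y_v) \<in> period_set D t \<and>
           (pA_w t, pS_w, y_w) \<in> period_set D t \<and>
           (\<forall>i\<in>storages D.
              e_v $ i \<in> {e_lo t $ i .. e_hi t $ i} \<and>
              e_w $ i \<in> {e_lo t $ i .. e_hi t $ i} \<and>
              e_v $ i = kappa_S D i * e $ i - energy_drop D i (pS_v $ i) \<and>
              e_w $ i = kappa_S D i * e $ i - energy_drop D i (pS_w $ i))))"

definition envelope_value ::
  "'n::finite distribution_data \<Rightarrow> ((nat \<Rightarrow> real) \<Rightarrow> (nat \<Rightarrow> real) \<Rightarrow> real) \<Rightarrow> ereal" where
  "envelope_value D \<phi> =
     Sup {ereal (\<phi> pA_v pA_w) | pA_v pS_v y_v pA_w pS_w y_w e_lo p_lo e_hi p_hi.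
            envelope_feasible D pA_v pS_v y_v pA_w pS_w y_w e_lo p_lo e_hi p_hi}"

definition rectangular_value ::
  "'n::finite distribution_data \<Rightarrow> ((nat \<Rightarrow> real) \<Rightarrow> (nat \<Rightarrow> real) \<Rightarrow> real) \<Rightarrow> ereal" where
  "rectangular_value D \<phi> =
     Sup {ereal (\<phi> pA_v pA_w) | pA_v pA_w e_lo e_hi.
            rectangular_feasible D pA_v pA_w e_lo e_hi}"

end

theory Submission
  imports Defs
begin

text \<open>
  Since \<open>energy_drop\<close> is nondecreasing in the power, the storage dispatch of the envelope solution,
  which lies between \<open>p_lo\<close> and \<open>p_hi\<close>, takes every energy level between \<open>e_lo (t - 1)\<close> and
  \<open>e_hi (t - 1)\<close> to one between \<open>e_lo t\<close> and \<open>e_hi t\<close>. Hence that one dispatch, chosen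
  independently of the current energy level, witnesses rectangular feasibility.
\<close>

lemma energy_drop_mono:
  assumes "distribution_system D" "i \<in> storages D" "p \<le> q"
  shows "energy_drop D i p \<le> energy_drop D i q"
proof -
  have "tau D > 0" "eta_SD D i > 0" "eta_SC D i > 0"
    using assms by (auto simp: distribution_system_def)
  with \<open>p \<le> q\<close> show ?thesis
    unfolding energy_drop_def
    by (intro add_mono divide_right_mono mult_right_mono) auto
qed

text \<open>More stored energy before the step and less power drawn during it leave more energy
  after it, because the retention factor \<open>kappa_S\<close> is positive and the drop is monotone
  in the power. Every comparison of trajectories below is an instance.\<close>

lemma energy_step_mono:
  assumes "distribution_system D" "i \<in> storages D" "e \<le> e'" "p' \<le> p"
  shows "kappa_S D i * e - energy_drop D i p \<le> kappa_S D i * e' - energy_drop D i p'"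
proof -
  have "kappa_S D i > 0"
    using assms by (auto simp: distribution_system_def)
  then show ?thesis
    using assms energy_drop_mono[of D i p' p] by (intro diff_mono mult_left_mono) auto
qed

text \<open>The envelope constraints never order the two energy bounds directly. Both start at
  \<open>e_S_init\<close>, and from then on \<open>e_hi\<close> is driven by the smaller power
  \<open>p_lo\<close> and \<open>e_lo\<close> by the larger \<open>p_hi\<close>, so induction keeps
  them ordered.\<close>

lemma envelope_lo_le_hi:
  assumes sys: "distribution_system D" and i: "i \<in> storages D"
    and env: "envelope_feasible D pA_v pS_v y_v pA_w pS_w y_w e_lo p_lo e_hi p_hi"
    and "t \<le> horizon D"
  shows "e_lo t $ i \<le> e_hi t $ i"
  using \<open>t \<le> horizon D\<close>
proof (induction t)
  case 0
  show ?case using env i by (simp add: envelope_feasible_def)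
next
  case (Suc t)
  then have "Suc t \<in> {1..horizon D}" by simp
  \<comment> \<open>\<open>p_lo\<close> and \<open>p_hi\<close> are comparable only through a
    dispatch lying between them; \<open>pS_v\<close> serves here.\<close>
  with env i have
    "e_hi (Suc t) $ i = kappa_S D i * e_hi (Suc t - 1) $ i - energy_drop D i (p_lo (Suc t) $ i)"
    "e_lo (Suc t) $ i = kappa_S D i * e_lo (Suc t - 1) $ i - energy_drop D i (p_hi (Suc t) $ i)"
    "p_lo (Suc t) $ i \<le> pS_v (Suc t) $ i" "pS_v (Suc t) $ i \<le> p_hi (Suc t) $ i"
    unfolding envelope_feasible_def by blast+
  then show ?case
    using energy_step_mono[OF sys i, of "e_lo t $ i" "e_hi t $ i"] Suc by simp
qed

lemma envelope_imp_rectangular: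
  assumes sys: "distribution_system D"
    and env: "envelope_feasible D pA_v pS_v y_v pA_w pS_w y_w e_lo p_lo e_hi p_hi"
  shows "rectangular_feasible D pA_v pA_w e_lo e_hi"
proof -
  have energy_bounds: "E_S_min D i \<le> e_lo t $ i \<and> e_lo t $ i \<le> e_hi t $ i \<and> e_hi t $ i \<le> E_S_max D i"
    if i: "i \<in> storages D" and t: "t \<in> {0..horizon D}" for i t
  proof (cases "t = 0")
    \<comment> \<open>The envelope model bounds the energies only from period 1 on; at time 0 the
      bounds come from those on \<open>e_S_init\<close>.\<close>
    case True
    with sys env i show ?thesis
      by (simp add: envelope_feasible_def distribution_system_def)
  next
    case False
    with t have "t \<in> {1..horizon D}" by simp
    with env i have "E_S_min D i \<le> e_lo t $ i" "e_hi t $ i \<le> E_S_max D i"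
      unfolding envelope_feasible_def by blast+
    with envelope_lo_le_hi[OF sys i env, of t] t show ?thesis by simp
  qed
  have step: "\<exists>e_v\<in>supported_on (storages D). \<exists>pS_v y_v.
         \<exists>e_w\<in>supported_on (storages D). \<exists>pS_w y_w.
           (pA_v t, pS_v, y_v) \<in> period_set D t \<and>
           (pA_w t, pS_w, y_w) \<in> period_set D t \<and>
           (\<forall>i\<in>storages D.
              e_v $ i \<in> {e_lo t $ i .. e_hi t $ i} \<and>
              e_w $ i \<in> {e_lo t $ i .. e_hi t $ i} \<and>
              e_v $ i = kappa_S D i * e $ i - energy_drop D i (pS_v $ i) \<and>
              e_w $ i = kappa_S D i * e $ i - energy_drop D i (pS_w $ i))"
    if t: "t \<in> {1..horizon D}"
      and e: "\<forall>i\<in>storages D. e $ i \<in> {e_lo (t - 1) $ i .. e_hi (t - 1) $ i}" for t e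
  proof -
    \<comment> \<open>The dynamics force this successor of \<open>e\<close> under dispatch
      \<open>p\<close>; the value 0 elsewhere puts it in \<open>supported_on\<close>.\<close>
    define next_e where "next_e p = (\<chi> i. if i \<in> storages D
      then kappa_S D i * e $ i - energy_drop D i (p $ i) else 0)" for p :: "real ^ 'a"
    have next_e_bounds: "next_e p $ i \<in> {e_lo t $ i .. e_hi t $ i}"
      if i: "i \<in> storages D" and p: "p_lo t $ i \<le> p $ i" "p $ i \<le> p_hi t $ i" for p i
    proof -
      have
        "e_hi t $ i = kappa_S D i * e_hi (t - 1) $ i - energy_drop D i (p_lo t $ i)"
        "e_lo t $ i = kappa_S D i * e_lo (t - 1) $ i - energy_drop D i (p_hi t $ i)"
        using env i t unfolding envelope_feasible_def by blast+
      then show ?thesis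
        using energy_step_mono[OF sys i] e i p by (simp add: next_e_def)
    qed
    have dispatch: "p_lo t $ i \<le> pS_v t $ i" "pS_v t $ i \<le> p_hi t $ i"
      "p_lo t $ i \<le> pS_w t $ i" "pS_w t $ i \<le> p_hi t $ i" if "i \<in> storages D" for i
      using env t that unfolding envelope_feasible_def by blast+
    have "(pA_v t, pS_v t, y_v t) \<in> period_set D t" "(pA_w t, pS_w t, y_w t) \<in> period_set D t"
      using env t unfolding envelope_feasible_def by blast+
    moreover have "next_e p \<in> supported_on (storages D)" for p
      by (simp add: next_e_def supported_on_def)
    moreover have "next_e p $ i = kappa_S D i * e $ i - energy_drop D i (p $ i)"
      if "i \<in> storages D" for p i
      using that by (simp add: next_e_def)
    \<comment> \<open>The witnesses are \<open>pS_v t\<close>, \<open>y_v t\<close>,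
      \<open>pS_w t\<close>, \<open>y_w t\<close> and the two vectors
      \<open>next_e (pS_v t)\<close>, \<open>next_e (pS_w t)\<close>; only the latter two vary with
      \<open>e\<close>.\<close>
    ultimately show ?thesis
      using next_e_bounds dispatch by meson
  qed
  show ?thesis
    unfolding rectangular_feasible_def
    using env energy_bounds step by (simp add: envelope_feasible_def)
qed

theorem proposition8:
  fixes D :: "'n::finite distribution_data"
    and \<phi> :: "(nat \<Rightarrow> real) \<Rightarrow> (nat \<Rightarrow> real) \<Rightarrow> real"
  assumes "distribution_system D"
  shows "(\<forall>pA_v pS_v y_v pA_w pS_w y_w e_lo p_lo e_hi p_hi.
            envelope_feasible D pA_v pS_v y_v pA_w pS_w y_w e_lo p_lo e_hi p_hi \<longrightarrow>
            rectangular_feasible D pA_v pA_w e_lo e_hi) \<and>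
         envelope_value D \<phi> \<le> rectangular_value D \<phi>"
proof
  show "\<forall>pA_v pS_v y_v pA_w pS_w y_w e_lo p_lo e_hi p_hi.
            envelope_feasible D pA_v pS_v y_v pA_w pS_w y_w e_lo p_lo e_hi p_hi \<longrightarrow>
            rectangular_feasible D pA_v pA_w e_lo e_hi"
    using envelope_imp_rectangular[OF assms] by blast
  \<comment> \<open>The objective sees only \<open>pA_v\<close> and \<open>pA_w\<close>, which carry
    over unchanged, so the values attained in the envelope model form a subset.\<close>
  show "envelope_value D \<phi> \<le> rectangular_value D \<phi>"
    unfolding envelope_value_def rectangular_value_def
    by (rule Sup_subset_mono) (use envelope_imp_rectangular[OF assms] in blast)
qed

end
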